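(* Let $\mathsf{S}=(S,* )$ be a globally idempotent and non-degenerate semigroup and let $\mathsf{M}=(M,*,1)$ be a monoid. Let $f\colon \mathsf{S}\to |\mathsf{M}|$ be a non-degenerate homomorphism of semigroups. Then there is a unique homomorphism of monoids $f^{\flat}\colon\mathsf{TrHull}(\mathsf{S})\to\mathsf{M}$ such that $|f^{\flat}|\circ \mathfrak{M}_{\mathsf{S}}=f$.
   Context: Semigroups here are ordinary (set-theoretic) semigroups; $|-|$ denotes the forgetful functor from monoids to semigroups. For a semigroup $\mathsf{S}=(S,* )$, a left translation is a map $L\colon S\to S$ with $L(x*y)=L(x)*y$, and a right translation is a map $R\colon S\to S$ with $R(x*y)=x*R(y)$, for all $x,y\in S$. A multiplier is a pair $(L,R)$ of a left and a right translation such that $R(x)*y=x*L(y)$ for all $x,y\in S$. The translational hull $\mathsf{TrHull}(\mathsf{S})$ is the monoid of all multipliers, with product $(L',R')\star(L,R)=(L'\circ L,R\circ R')$ and identity $(id_S,id_S)$. The canonical homomorphism $\mathfrak{M}_{\mathsf{S}}\colon \mathsf{S}\to|\mathsf{TrHull}(\mathsf{S})|$ is $x\mapsto(\mathfrak{L}_x,\mathfrak{R}_x)$ with $\mathfrak{L}_x(y)=x*y$, $\mathfrak{R}_x(y)=y*x$. A semigroup $(S,* )$ is globally idempotent when $S=\{x*y\colon x,y\in S\}$. It is non-degenerate when both: ($x*y=x*z$ for all $x\in S$ implies $y=z$) and ($y*x=z*x$ for all $x\in S$ implies $y=z$). A map $f\colon S\to T$ from a set to a semigroup $(T,* )$ is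 non-degenerate when $T=\{f(s)*t\colon s\in S,\ t\in T\}=\{t*f(s)\colon s\in S,\ t\in T\}$. *)

theory Defs
  imports "HOL-Algebra.Group"
begin

text \<open>
  Semigroups follow the conventions of HOL-Algebra: an explicit carrier, which may be empty, and
  an operation that is only meaningful on the carrier. Self-maps of the carrier that are
  themselves elements of a structure (translations) are taken to be extensional, as for
  \<^const>\<open>compose\<close>, so that equality of such maps is equality on the carrier.
\<close>

record 'a sgrp = "'a partial_object" +
  smult :: "['a, 'a] \<Rightarrow> 'a" (infixl \<open>\<star>\<index>\<close> 70)

locale sgrp =
  fixes S (structure)
  assumes s_closed: "\<lbrakk>x \<in> carrier S; y \<in> carrier S\<rbrakk> \<Longrightarrow> x \<star> y \<in> carrier S"
    and s_assoc: "\<lbrakk>x \<in> carrier S; y \<in> carrier S; z \<in> carrier S\<rbrakk>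
      \<Longrightarrow> (x \<star> y) \<star> z = x \<star> (y \<star> z)"

definition sgrp_of_monoid :: "('a, 'm) monoid_scheme \<Rightarrow> 'a sgrp"
  where "sgrp_of_monoid M = \<lparr>carrier = carrier M, smult = mult M\<rparr>"

definition sgrp_hom :: "('a, 's) sgrp_scheme \<Rightarrow> ('b, 't) sgrp_scheme \<Rightarrow> ('a \<Rightarrow> 'b) set"
  where "sgrp_hom S T = {f \<in> carrier S \<rightarrow> carrier T.
    \<forall>x\<in>carrier S. \<forall>y\<in>carrier S. f (x \<star>\<^bsub>S\<^esub> y) = f x \<star>\<^bsub>T\<^esub> f y}"

text \<open>The library's \<^const>\<open>hom\<close> does not require preservation of the unit.\<close>

definition monoid_hom :: "('a, 'm) monoid_scheme \<Rightarrow> ('b, 'n) monoid_scheme \<Rightarrow> ('a \<Rightarrow> 'b) set"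
  where "monoid_hom M N = {h \<in> hom M N. h \<one>\<^bsub>M\<^esub> = \<one>\<^bsub>N\<^esub>}"

definition globally_idempotent :: "('a, 's) sgrp_scheme \<Rightarrow> bool"
  where "globally_idempotent S \<longleftrightarrow>
    carrier S = {x \<star>\<^bsub>S\<^esub> y | x y. x \<in> carrier S \<and> y \<in> carrier S}"

definition nondegenerate_sgrp :: "('a, 's) sgrp_scheme \<Rightarrow> bool"
  where "nondegenerate_sgrp S \<longleftrightarrow>
    (\<forall>y\<in>carrier S. \<forall>z\<in>carrier S. (\<forall>x\<in>carrier S. x \<star>\<^bsub>S\<^esub> y = x \<star>\<^bsub>S\<^esub> z) \<longrightarrow> y = z) \<and>
    (\<forall>y\<in>carrier S. \<forall>z\<in>carrier S. (\<forall>x\<in>carrier S. y \<star>\<^bsub>S\<^esub> x = z \<star>\<^bsub>S\<^esub> x) \<longrightarrow> y = z)"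

definition nondegenerate_map :: "'a set \<Rightarrow> ('b, 't) sgrp_scheme \<Rightarrow> ('a \<Rightarrow> 'b) \<Rightarrow> bool"
  where "nondegenerate_map A T f \<longleftrightarrow> f \<in> A \<rightarrow> carrier T \<and>
    carrier T = {f s \<star>\<^bsub>T\<^esub> t | s t. s \<in> A \<and> t \<in> carrier T} \<and>
    carrier T = {t \<star>\<^bsub>T\<^esub> f s | s t. s \<in> A \<and> t \<in> carrier T}"

definition left_translation :: "('a, 's) sgrp_scheme \<Rightarrow> ('a \<Rightarrow> 'a) \<Rightarrow> bool"
  where "left_translation S L \<longleftrightarrow> L \<in> carrier S \<rightarrow>\<^sub>E carrier S \<and>
    (\<forall>x\<in>carrier S. \<forall>y\<in>carrier S. L (x \<star>\<^bsub>S\<^esub> y) = L x \<star>\<^bsub>S\<^esub> y)"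

definition right_translation :: "('a, 's) sgrp_scheme \<Rightarrow> ('a \<Rightarrow> 'a) \<Rightarrow> bool"
  where "right_translation S R \<longleftrightarrow> R \<in> carrier S \<rightarrow>\<^sub>E carrier S \<and>
    (\<forall>x\<in>carrier S. \<forall>y\<in>carrier S. R (x \<star>\<^bsub>S\<^esub> y) = x \<star>\<^bsub>S\<^esub> R y)"

definition multipliers :: "('a, 's) sgrp_scheme \<Rightarrow> (('a \<Rightarrow> 'a) \<times> ('a \<Rightarrow> 'a)) set"
  where "multipliers S = {(L, R). left_translation S L \<and> right_translation S R \<and>
    (\<forall>x\<in>carrier S. \<forall>y\<in>carrier S. R x \<star>\<^bsub>S\<^esub> y = x \<star>\<^bsub>S\<^esub> L y)}"

definition TrHull :: "('a, 's) sgrp_scheme \<Rightarrow> (('a \<Rightarrow> 'a) \<times> ('a \<Rightarrow> 'a)) monoid"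
  where "TrHull S =
    \<lparr>carrier = multipliers S,
     mult = (\<lambda>(L', R') (L, R). (compose (carrier S) L' L, compose (carrier S) R R')),
     one = (\<lambda>x\<in>carrier S. x, \<lambda>x\<in>carrier S. x)\<rparr>"

definition canonical :: "('a, 's) sgrp_scheme \<Rightarrow> 'a \<Rightarrow> ('a \<Rightarrow> 'a) \<times> ('a \<Rightarrow> 'a)"
  where "canonical S x = (\<lambda>y\<in>carrier S. x \<star>\<^bsub>S\<^esub> y, \<lambda>y\<in>carrier S. y \<star>\<^bsub>S\<^esub> x)"

lemma sgrp_sgrp_of_monoid: "monoid M \<Longrightarrow> sgrp (sgrp_of_monoid M)"
  by (simp add: sgrp_def sgrp_of_monoid_def monoid.m_closed monoid.m_assoc)

lemma (in sgrp) monoid_TrHull: "monoid (TrHull S)"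
proof -
  note defs = TrHull_def multipliers_def left_translation_def right_translation_def
  have closed: "L x \<in> carrier S" "R x \<in> carrier S"
    if "(L, R) \<in> carrier (TrHull S)" "x \<in> carrier S" for L R x
    using that by (auto simp: defs PiE_def)
  show ?thesis
  proof (rule monoidI, goal_cases)
    case (1 p q)
    obtain L' R' L R where eq: "p = (L', R')" "q = (L, R)" by (cases p, cases q)
    have c: "L' x \<in> carrier S" "R' x \<in> carrier S" "L x \<in> carrier S" "R x \<in> carrier S"
      if "x \<in> carrier S" for x
      using closed 1 that unfolding eq by blast+
    have L: "L' (x \<star> y) = L' x \<star> y" "L (x \<star> y) = L x \<star> y"
      and R: "R' (x \<star> y) = x \<star> R' y" "R (x \<star> y) = x \<star> R y"
      and B: "R' x \<star> y = x \<star> L' y" "R x \<star> y = x \<star> L y"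
      if "x \<in> carrier S" "y \<in> carrier S" for x y
      using 1 that unfolding eq by (simp_all add: defs)
    have "left_translation S (compose (carrier S) L' L)"
      "right_translation S (compose (carrier S) R R')"
      by (auto simp: left_translation_def right_translation_def compose_def c L R s_closed)
    moreover have "compose (carrier S) R R' x \<star> y = x \<star> compose (carrier S) L' L y"
      if "x \<in> carrier S" "y \<in> carrier S" for x y
      using that by (simp add: compose_def c B)
    ultimately show ?case by (simp add: eq TrHull_def multipliers_def)
  next
    case 2
    show ?case by (auto simp: defs s_closed)
  next
    case (3 p q r)
    obtain L\<^sub>1 R\<^sub>1 L\<^sub>2 R\<^sub>2 L\<^sub>3 R\<^sub>3
      where eq: "p = (L\<^sub>1, R\<^sub>1)" "q = (L\<^sub>2, R\<^sub>2)" "r = (L\<^sub>3, R\<^sub>3)"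
      by (cases p, cases q, cases r)
    show ?case
      using closed 3 unfolding eq by (auto simp: TrHull_def compose_def fun_eq_iff)
  next
    case (4 p)
    then show ?case
      by (cases p) (auto simp: defs PiE_def intro: Id_compose compose_Id)
  next
    case (5 p)
    then show ?case
      by (cases p) (auto simp: defs PiE_def intro: Id_compose compose_Id)
  qed
qed

lemma (in sgrp) canonical_hom: "canonical S \<in> sgrp_hom S (sgrp_of_monoid (TrHull S))"
  by (auto simp: sgrp_hom_def sgrp_of_monoid_def canonical_def TrHull_def multipliers_def
      left_translation_def right_translation_def compose_def s_closed s_assoc fun_eq_iff)

end

theory Submission
  imports Defs
begin

text \<open>
  Non-degeneracy of \<open>f\<close> gives \<open>f s \<otimes> a = \<one> = b \<otimes> f t\<close> for some \<open>s\<close>, \<open>t\<close>, \<open>a\<close>, \<open>b\<close>. Since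
  \<open>canonical x \<otimes> (L, R) = canonical (R x)\<close>, the extension \<open>g\<close> must satisfy
  \<open>f x \<otimes> g (L, R) = f (R x)\<close>, and left multiplication by \<open>b\<close> at \<open>x = t\<close> shows that these equations
  determine \<open>g\<close>. Conversely, \<open>g (L, R) = f (L s) \<otimes> a\<close> solves them because
  \<open>f x \<otimes> f (L s) = f (R x) \<otimes> f s\<close>, and multiplicativity follows by cancellation.
\<close>

lemma mem_multipliersD:
  assumes "(L, R) \<in> multipliers S" "x \<in> carrier S"
  shows "L x \<in> carrier S" and "R x \<in> carrier S"
    and "y \<in> carrier S \<Longrightarrow> R x \<star>\<^bsub>S\<^esub> y = x \<star>\<^bsub>S\<^esub> L y"
    and "y \<in> carrier S \<Longrightarrow> R (y \<star>\<^bsub>S\<^esub> x) = y \<star>\<^bsub>S\<^esub> R x"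
  using assms
  by (auto simp: multipliers_def left_translation_def right_translation_def PiE_def)

lemma (in sgrp) canonical_in_TrHull:
  "x \<in> carrier S \<Longrightarrow> canonical S x \<in> carrier (TrHull S)"
  using canonical_hom by (auto simp: sgrp_hom_def sgrp_of_monoid_def)

text \<open>The left components agree by the linking condition \<open>R x * y = x * L y\<close>, the
  right ones because \<open>R\<close> is a right translation.\<close>

lemma canonical_mult_multiplier:
  assumes "(L, R) \<in> multipliers S" "x \<in> carrier S"
  shows "canonical S x \<otimes>\<^bsub>TrHull S\<^esub> (L, R) = canonical S (R x)"
  using assms
  by (auto simp: TrHull_def canonical_def compose_def fun_eq_iff mem_multipliersD)

theorem theorem59:
  fixes S :: "('a, 's) sgrp_scheme" and M :: "('b, 'm) monoid_scheme" and f :: "'a \<Rightarrow> 'b"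
  assumes "sgrp S" and "globally_idempotent S" and "nondegenerate_sgrp S"
    and "monoid M"
    and "f \<in> sgrp_hom S (sgrp_of_monoid M)"
    and "nondegenerate_map (carrier S) (sgrp_of_monoid M) f"
  shows "\<exists>!g. g \<in> monoid_hom (TrHull S) M \<and> g \<in> extensional (carrier (TrHull S)) \<and>
    (\<forall>x\<in>carrier S. g (canonical S x) = f x)"
proof -
  interpret S: sgrp S by fact
  interpret M: monoid M by fact
  interpret T: monoid "TrHull S" by (rule S.monoid_TrHull)
  have f_closed: "f x \<in> carrier M" if "x \<in> carrier S" for x
    using assms(5) that by (auto simp: sgrp_hom_def sgrp_of_monoid_def)
  have f_mult: "f (x \<star>\<^bsub>S\<^esub> y) = f x \<otimes>\<^bsub>M\<^esub> f y" if "x \<in> carrier S" "y \<in> carrier S" for x y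
    using assms(5) that by (auto simp: sgrp_hom_def sgrp_of_monoid_def)
  have M_eq: "carrier M = {f s \<otimes>\<^bsub>M\<^esub> m | s m. s \<in> carrier S \<and> m \<in> carrier M}"
    "carrier M = {m \<otimes>\<^bsub>M\<^esub> f s | s m. s \<in> carrier S \<and> m \<in> carrier M}"
    using assms(6) by (simp_all add: nondegenerate_map_def sgrp_of_monoid_def)
  obtain s a where s: "s \<in> carrier S" "a \<in> carrier M" "f s \<otimes>\<^bsub>M\<^esub> a = \<one>\<^bsub>M\<^esub>"
    using M_eq(1) M.one_closed by (smt (verit) mem_Collect_eq)
  obtain t b where t: "t \<in> carrier S" "b \<in> carrier M" "b \<otimes>\<^bsub>M\<^esub> f t = \<one>\<^bsub>M\<^esub>"
    using M_eq(2) M.one_closed by (smt (verit) mem_Collect_eq)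
  \<comment> \<open>The translates by all \<open>f x\<close> separate points of \<open>M\<close>.
    Each equality below that involves \<open>g\<close> as an unknown factor is tested this
    way.\<close>
  have cancel: "m = n"
    if "m \<in> carrier M" "n \<in> carrier M" "\<And>x. x \<in> carrier S \<Longrightarrow> f x \<otimes>\<^bsub>M\<^esub> m = f x \<otimes>\<^bsub>M\<^esub> n" for m n
  proof -
    have "b \<otimes>\<^bsub>M\<^esub> f t \<otimes>\<^bsub>M\<^esub> m = b \<otimes>\<^bsub>M\<^esub> f t \<otimes>\<^bsub>M\<^esub> n"
      using that t(1,2) f_closed by (simp add: M.m_assoc)
    then show ?thesis using that t by simp
  qed
  \<comment> \<open>The value is forced: \<open>(L, R)\<close> times \<open>canonical S s\<close> is
    \<open>canonical S (L s)\<close>, so an extension sends \<open>(L, R)\<close> to its value times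
    \<open>f s\<close> times \<open>a\<close>, which is \<open>f (L s)\<close> times
    \<open>a\<close>.\<close>
  define g where "g = (\<lambda>p\<in>carrier (TrHull S). f (fst p s) \<otimes>\<^bsub>M\<^esub> a)"
  have g_closed: "g p \<in> carrier M" if "p \<in> carrier (TrHull S)" for p
    using that s f_closed by (cases p) (auto simp: g_def TrHull_def mem_multipliersD)
  have g_eq: "f x \<otimes>\<^bsub>M\<^esub> g p = f (snd p x)"
    if "p \<in> carrier (TrHull S)" "x \<in> carrier S" for p x
  proof (cases p)
    case (Pair L R)
    then have p: "(L, R) \<in> multipliers S" using that by (simp add: TrHull_def)
    have Ls: "L s \<in> carrier S" and Rx: "R x \<in> carrier S"
      using mem_multipliersD[OF p] s that by auto
    have "f x \<otimes>\<^bsub>M\<^esub> g p = f (x \<star>\<^bsub>S\<^esub> L s) \<otimes>\<^bsub>M\<^esub> a"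
      using that Pair s Ls f_closed by (simp add: g_def f_mult M.m_assoc)
    \<comment> \<open>Linking moves the multiplier from \<open>s\<close> to \<open>x\<close>, so
      that \<open>f s\<close> meets its right inverse \<open>a\<close>.\<close>
    also have "\<dots> = f (R x \<star>\<^bsub>S\<^esub> s) \<otimes>\<^bsub>M\<^esub> a"
      using mem_multipliersD(3)[OF p that(2) s(1)] by simp
    also have "\<dots> = f (R x)"
      using s Rx f_closed by (simp add: f_mult M.m_assoc)
    finally show ?thesis using Pair by simp
  qed
  have snd_closed: "snd p x \<in> carrier S" if "p \<in> carrier (TrHull S)" "x \<in> carrier S" for p x
    using that by (cases p) (auto simp: TrHull_def mem_multipliersD)
  have g_mult: "g (p \<otimes>\<^bsub>TrHull S\<^esub> q) = g p \<otimes>\<^bsub>M\<^esub> g q"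
    if "p \<in> carrier (TrHull S)" "q \<in> carrier (TrHull S)" for p q
  proof (rule cancel)
    fix x assume x: "x \<in> carrier S"
    have "f x \<otimes>\<^bsub>M\<^esub> g (p \<otimes>\<^bsub>TrHull S\<^esub> q) = f (snd (p \<otimes>\<^bsub>TrHull S\<^esub> q) x)"
      using that x by (simp add: g_eq)
    \<comment> \<open>Right components compose in reverse, which is the order in which
      \<open>f x\<close> absorbs first \<open>g p\<close> and then \<open>g q\<close>.\<close>
    also have "\<dots> = f (snd q (snd p x))"
      using x by (simp add: TrHull_def split_beta compose_def)
    also have "\<dots> = f x \<otimes>\<^bsub>M\<^esub> g p \<otimes>\<^bsub>M\<^esub> g q"
      using that x by (simp add: g_eq snd_closed)
    finally show "f x \<otimes>\<^bsub>M\<^esub> g (p \<otimes>\<^bsub>TrHull S\<^esub> q) = f x \<otimes>\<^bsub>M\<^esub> (g p \<otimes>\<^bsub>M\<^esub> g q)"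
      using that x by (simp add: M.m_assoc f_closed g_closed)
  qed (use that g_closed in auto)
  have g_one: "g \<one>\<^bsub>TrHull S\<^esub> = \<one>\<^bsub>M\<^esub>"
    by (rule cancel) (simp_all add: g_closed g_eq f_closed, simp add: TrHull_def)
  have g_canonical: "g (canonical S x) = f x" if "x \<in> carrier S" for x
  proof (rule cancel)
    fix y assume "y \<in> carrier S"
    \<comment> \<open>The right component of \<open>canonical S x\<close> sends \<open>y\<close> to
      \<open>y * x\<close>, so \<open>g_eq\<close> turns the left side into
      \<open>f (y * x)\<close>.\<close>
    then show "f y \<otimes>\<^bsub>M\<^esub> g (canonical S x) = f y \<otimes>\<^bsub>M\<^esub> f x"
      using that by (simp add: g_eq S.canonical_in_TrHull f_mult[symmetric])
        (simp add: canonical_def)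
  qed (use that in \<open>simp_all add: g_closed S.canonical_in_TrHull f_closed\<close>)
  show ?thesis
  proof (rule ex1I[of _ g], intro conjI ballI)
    show "g \<in> monoid_hom (TrHull S) M"
      by (auto simp: monoid_hom_def hom_def g_closed g_mult g_one)
    show "g \<in> extensional (carrier (TrHull S))"
      by (simp add: g_def)
    show "g (canonical S x) = f x" if "x \<in> carrier S" for x
      using that by (rule g_canonical)
  next
    fix h
    assume h: "h \<in> monoid_hom (TrHull S) M \<and> h \<in> extensional (carrier (TrHull S)) \<and>
      (\<forall>x\<in>carrier S. h (canonical S x) = f x)"
    then have h_closed: "h p \<in> carrier M" if "p \<in> carrier (TrHull S)" for p
      using that by (auto simp: monoid_hom_def hom_def)
    have "h p = g p" if p: "p \<in> carrier (TrHull S)" for p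
    proof (rule cancel)
      fix x assume x: "x \<in> carrier S"
      \<comment> \<open>Reading \<open>f x\<close> as \<open>h (canonical S x)\<close> shows that
        \<open>h\<close> solves the same equations as \<open>g\<close>.\<close>
      have "f x \<otimes>\<^bsub>M\<^esub> h p = h (canonical S x \<otimes>\<^bsub>TrHull S\<^esub> p)"
        using h p x S.canonical_in_TrHull by (auto simp: monoid_hom_def hom_mult)
      also have "canonical S x \<otimes>\<^bsub>TrHull S\<^esub> p = canonical S (snd p x)"
        using canonical_mult_multiplier[of "fst p" "snd p" S x] p x by (simp add: TrHull_def)
      also have "h \<dots> = f x \<otimes>\<^bsub>M\<^esub> g p"
        using h p x by (simp add: snd_closed g_eq)
      finally show "f x \<otimes>\<^bsub>M\<^esub> h p = f x \<otimes>\<^bsub>M\<^esub> g p" .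
    qed (use p h_closed g_closed in auto)
    then show "h = g"
      using h by (intro extensionalityI[of _ "carrier (TrHull S)"]) (auto simp: g_def)
  qed
qed

end
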